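(* Let $Y$ be a convergence-approach space. (i) If $Y$ is regular, then for every convergence-approach space $X$ and every $f\in Y^{X}$, $$m_{+}(f)\leq2\bigwedge_{\mathcal{F}\in\mathbb{F}(Y^{X})}\lambda_{[X,Y]}(\mathcal{F})(f).$$ (ii) If $Y$ is not regular, then there are a topological space $X$ (viewed as a convergence-approach space) and $f\in Y^{X}$ with $$\bigwedge_{\mathcal{F}\in\mathbb{F}(Y^{X})}\lambda_{[X,Y]}(\mathcal{F})(f)<m_{+}(f).$$
   Context: Filters are proper. $\mathbb{F}X$ is the set of filters on $X$, ordered by inclusion; $\mathbb{U}X$ is the set of ultrafilters; $\mathcal{F}\wedge\mathcal{G}=\mathcal{F}\cap\mathcal{G}$; $\mathcal{A}^{\uparrow}=\{B\subseteq X:\exists A\in\mathcal{A},\ A\subseteq B\}$; $\{x\}^{\uparrow}$ is the principal ultrafilter at $x$. A filter base is identified with the filter it generates. $f[\mathcal{F}]=\{f(F):F\in\mathcal{F}\}^{\uparrow}$. A convergence-approach space is a pair $(X,\lambda_X)$ with $\lambda_X:\mathbb{F}X\to[0,\infty]^{X}$ (ordered pointwise) such that $\lambda_X(\mathcal{F}\wedge\mathcal{G})=\lambda_X(\mathcal{F})\vee\lambda_X(\mathcal{G})$ for all $\mathcal{F},\mathcal{G}\in\mathbb{F}X$ and $\lambda_X(\{x\}^{\uparrow})(x)=0$ for all $x\in X$. A topological space is viewed as a convergence-approach space via $\lambda_X(\mathcal{F})(x)=0$ if $\mathcal{F}$ contains the neighborhood filter of $x$, and $\infty$ otherwise. For $A\subseteq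 X$ and $\epsilon\ge0$, $A^{(\epsilon)}=\{x\in X:\exists\,\mathcal{U}\in\mathbb{U}X,\ A\in\mathcal{U},\ \lambda_X(\mathcal{U})(x)\le\epsilon\}$, and $\mathcal{F}^{(\epsilon)}=\{F^{(\epsilon)}:F\in\mathcal{F}\}$. A convergence-approach space is regular if $\lambda_X(\mathcal{F}^{(\epsilon)})\le\lambda_X(\mathcal{F})+\epsilon$ for all $\mathcal{F}\in\mathbb{F}X$, $\epsilon\in[0,\infty]$ (with $a+\infty=\infty$ for all $a\in[0,\infty]$). For $f\in Y^{X}$ (the set of all functions $X\to Y$) and $\mathcal{F}\in\mathbb{F}(Y^{X})$, $$\lambda_{[X,Y]}(\mathcal{F})(f)=\inf\{\alpha\in[0,\infty]:\forall\mathcal{G}\in\mathbb{F}X,\ \lambda_{Y}(\langle\mathcal{G},\mathcal{F}\rangle)\circ f\le\lambda_{X}(\mathcal{G})\vee\alpha\},$$ where $\langle\mathcal{G},\mathcal{F}\rangle=\{\langle G,F\rangle:G\in\mathcal{G},F\in\mathcal{F}\}^{\uparrow}$ and $\langle G,F\rangle=\{h(x):h\in F,x\in G\}$; and $$m_{+}(f)=\inf\{\alpha\in[0,\infty]:\forall\mathcal{G}\in\mathbb{F}X,\ \lambda_{Y}(f[\mathcal{G}])\circ f\le\lambda_{X}(\mathcal{G})+\alpha\}.$$ *)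

theory Defs
  imports "HOL-Analysis.Analysis"
begin

(*
  A space is a carrier set X with a limit function lam. Filters on X are the proper HOL filters
  below principal X, and lam is only ever consulted at such filters and at points of X. The order
  of 'a filter is the reverse of inclusion of set systems: F <= G says that every set of G belongs
  to F, and sup F G is the intersection of F and G.
*)

definition filters_on :: "'a set \<Rightarrow> 'a filter set"
  where "filters_on X = {F. F \<noteq> bot \<and> F \<le> principal X}"

definition ultrafilters_on :: "'a set \<Rightarrow> 'a filter set"
  where "ultrafilters_on X = {U \<in> filters_on X. \<forall>G \<in> filters_on X. G \<le> U \<longrightarrow> G = U}"

locale convergence_approach_space =
  fixes X :: "'a set" and lam :: "'a filter \<Rightarrow> 'a \<Rightarrow> ennreal"
  assumes lam_sup: "\<lbrakk>F \<in> filters_on X; G \<in> filters_on X; x \<in> X\<rbrakk>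
      \<Longrightarrow> lam (sup F G) x = sup (lam F x) (lam G x)"
    and lam_point: "x \<in> X \<Longrightarrow> lam (principal {x}) x = 0"

definition topological_lam :: "'a topology \<Rightarrow> 'a filter \<Rightarrow> 'a \<Rightarrow> ennreal"
  where "topological_lam T F x = (if F \<le> nhdsin T x then 0 else \<infinity>)"

lemma convergence_approach_space_topological:
  "convergence_approach_space (topspace T) (topological_lam T)"
proof
  fix x assume "x \<in> topspace T"
  then show "topological_lam T (principal {x}) x = 0"
    by (auto simp: topological_lam_def le_filter_def eventually_principal eventually_nhdsin)
qed (auto simp: topological_lam_def sup_ennreal_def)

definition adherence ::
  "'a set \<Rightarrow> ('a filter \<Rightarrow> 'a \<Rightarrow> ennreal) \<Rightarrow> ennreal \<Rightarrow> 'a set \<Rightarrow> 'a set"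
  where "adherence X lam \<epsilon> A =
    {x \<in> X. \<exists>U \<in> ultrafilters_on X. eventually (\<lambda>z. z \<in> A) U \<and> lam U x \<le> \<epsilon>}"

definition adherence_filter ::
  "'a set \<Rightarrow> ('a filter \<Rightarrow> 'a \<Rightarrow> ennreal) \<Rightarrow> ennreal \<Rightarrow> 'a filter \<Rightarrow> 'a filter"
  where "adherence_filter X lam \<epsilon> F =
    (INF A \<in> {A. A \<subseteq> X \<and> eventually (\<lambda>z. z \<in> A) F}. principal (adherence X lam \<epsilon> A))"

definition regular_approach :: "'a set \<Rightarrow> ('a filter \<Rightarrow> 'a \<Rightarrow> ennreal) \<Rightarrow> bool"
  where "regular_approach X lam \<longleftrightarrow>
    (\<forall>F \<in> filters_on X. \<forall>\<epsilon>. \<forall>x \<in> X. lam (adherence_filter X lam \<epsilon> F) x \<le> lam F x + \<epsilon>)"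

definition eval_filter :: "'a filter \<Rightarrow> ('a \<Rightarrow> 'b) filter \<Rightarrow> 'b filter"
  where "eval_filter G F = filtermap (\<lambda>(x, h). h x) (G \<times>\<^sub>F F)"

(* The function space is the set of extensional functions X \<rightarrow>\<^sub>E Y. *)

definition hom_lam ::
  "'a set \<Rightarrow> ('a filter \<Rightarrow> 'a \<Rightarrow> ennreal) \<Rightarrow> ('b filter \<Rightarrow> 'b \<Rightarrow> ennreal)
    \<Rightarrow> ('a \<Rightarrow> 'b) filter \<Rightarrow> ('a \<Rightarrow> 'b) \<Rightarrow> ennreal"
  where "hom_lam X lamX lamY F f =
    Inf {\<alpha>. \<forall>G \<in> filters_on X. \<forall>x \<in> X. lamY (eval_filter G F) (f x) \<le> sup (lamX G x) \<alpha>}"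

definition m_plus ::
  "'a set \<Rightarrow> ('a filter \<Rightarrow> 'a \<Rightarrow> ennreal) \<Rightarrow> ('b filter \<Rightarrow> 'b \<Rightarrow> ennreal)
    \<Rightarrow> ('a \<Rightarrow> 'b) \<Rightarrow> ennreal"
  where "m_plus X lamX lamY f =
    Inf {\<alpha>. \<forall>G \<in> filters_on X. \<forall>x \<in> X. lamY (filtermap f G) (f x) \<le> lamX G x + \<alpha>}"

(* The filters defined above by lattice and product operations are the upward closures of the
   expected families of sets. *)

lemma eventually_adherence_filter:
  assumes "F \<le> principal X"
  shows "eventually P (adherence_filter X lam \<epsilon> F) \<longleftrightarrow>
    (\<exists>A \<subseteq> X. eventually (\<lambda>z. z \<in> A) F \<and> (\<forall>y \<in> adherence X lam \<epsilon> A. P y))"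
proof -
  let ?B = "{A. A \<subseteq> X \<and> eventually (\<lambda>z. z \<in> A) F}"
  have mono: "adherence X lam \<epsilon> A \<subseteq> adherence X lam \<epsilon> B" if "A \<subseteq> B" for A B
    using that unfolding adherence_def by (blast intro: eventually_mono)
  have ne: "?B \<noteq> {}"
    using assms by (auto simp: le_principal)
  have dir: "\<exists>C \<in> ?B. principal (adherence X lam \<epsilon> C)
      \<le> inf (principal (adherence X lam \<epsilon> A)) (principal (adherence X lam \<epsilon> B))"
    if "A \<in> ?B" "B \<in> ?B" for A B
    using that mono[of "A \<inter> B" A] mono[of "A \<inter> B" B]
    by (intro bexI[of _ "A \<inter> B"]) (auto intro: eventually_conj)
  show ?thesis
    unfolding adherence_filter_def
    by (subst eventually_INF_base[OF ne dir]) (auto simp: eventually_principal)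
qed

lemma eventually_eval_filter:
  "eventually P (eval_filter G F) \<longleftrightarrow>
    (\<exists>A B. eventually (\<lambda>x. x \<in> A) G \<and> eventually (\<lambda>h. h \<in> B) F \<and> (\<forall>x\<in>A. \<forall>h\<in>B. P (h x)))"
  (is "?L \<longleftrightarrow> ?R")
proof
  assume ?L
  then obtain Q R where "eventually Q G" "eventually R F" "\<And>x h. Q x \<Longrightarrow> R h \<Longrightarrow> P (h x)"
    unfolding eval_filter_def eventually_filtermap eventually_prod_filter by auto
  then show ?R
    by (intro exI[of _ "Collect Q"] exI[of _ "Collect R"]) auto
next
  assume ?R
  then show ?L
    unfolding eval_filter_def eventually_filtermap eventually_prod_filter by fast
qed

end

theory Submission
  imports Defs
begin

text \<open>
  Part (i). Suppose that \<open>\<alpha>\<close> is admissible in the infimum defining the limit of a function filter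
  \<open>F\<close> at \<open>f\<close>. Principal filters of points converge at level \<open>0\<close>, so the filter \<open>\<langle>{x}, F\<rangle>\<close> converges
  to \<open>f x\<close> at level \<open>\<alpha>\<close>, for every point \<open>x\<close>. An ultrafilter finer than it converges at least as
  well, and it contains every \<open>\<langle>A, B\<rangle>\<close> with \<open>x \<in> A\<close> and \<open>B \<in> F\<close>; hence \<open>f x\<close> lies in the
  \<open>\<alpha>\<close>-adherence of \<open>\<langle>A, B\<rangle>\<close>. This says that the image filter \<open>f[G]\<close> is finer than the
  \<open>\<alpha>\<close>-adherence of \<open>\<langle>G, F\<rangle>\<close> (lemma \<open>filtermap_le_adherence_eval_filter\<close>). Regularity of the
  codomain costs one \<open>\<alpha>\<close>, and the bound \<open>\<lambda>(G) \<or> \<alpha>\<close> for \<open>\<langle>G, F\<rangle>\<close> costs the other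
  (lemma \<open>half_m_plus_le_hom_lam\<close>).

  Part (ii). A failure of regularity is a filter \<open>F\<close>, a level \<open>\<epsilon>\<close> and a point \<open>y0\<close> such that the
  \<open>\<epsilon>\<close>-adherence of \<open>F\<close> converges to \<open>y0\<close> worse than \<open>\<lambda>(F)(y0) + \<epsilon>\<close>. The adherence filter is
  unfolded into a topological space: there is one isolated point for each pair of a set \<open>A\<close> of \<open>F\<close>
  and a point \<open>y\<close> adherent to \<open>A\<close>, and one further point, whose punctured neighborhoods consist of
  all pairs with \<open>A\<close> small. Let \<open>f\<close> send a pair to \<open>y\<close> and the further point to \<open>y0\<close>. Then
  \<open>f\<close> maps the punctured neighborhood filter to the adherence filter, so the defect \<open>m\<^sub>+(f)\<close> is large
  (lemma \<open>lam_adherence_filter_le_m_plus\<close>).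
  On the other hand each pair comes with an ultrafilter that contains \<open>A\<close> and converges to \<open>y\<close> at
  level \<open>\<epsilon>\<close>. Choosing values independently along these ultrafilters gives a filter of functions (the
  box filter) that converges to \<open>f\<close> at level at most \<open>max (\<lambda>(F)(y0)) \<epsilon>\<close>: at the isolated points
  the values follow the ultrafilters, and near the further point they lie in small sets of \<open>F\<close>
  (lemma \<open>exists_function_filter_hom_lam_le\<close>).
\<close>

section \<open>Filters on a carrier set\<close>

lemma principal_in_filters_on: "x \<in> X \<Longrightarrow> principal {x} \<in> filters_on X"
  by (auto simp: filters_on_def principal_eq_bot_iff)

lemma filters_on_anti_mono:
  "\<lbrakk>G \<in> filters_on X; F \<le> G; F \<noteq> bot\<rbrakk> \<Longrightarrow> F \<in> filters_on X"
  by (auto simp: filters_on_def)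

lemma filters_on_eventually_carrier: "F \<in> filters_on X \<Longrightarrow> eventually (\<lambda>x. x \<in> X) F"
  by (simp add: filters_on_def le_principal)

lemma filtermap_in_filters_on:
  "\<lbrakk>G \<in> filters_on X; f \<in> X \<rightarrow> Y\<rbrakk> \<Longrightarrow> filtermap f G \<in> filters_on Y"
  by (auto simp: filters_on_def filtermap_bot_iff le_principal eventually_filtermap
      elim: eventually_mono)

lemma eval_filter_in_filters_on:
  assumes G: "G \<in> filters_on X" and F: "F \<in> filters_on (X \<rightarrow>\<^sub>E Y)"
  shows "eval_filter G F \<in> filters_on Y"
proof -
  have "eventually (\<lambda>y. y \<in> Y) (eval_filter G F)"
    unfolding eventually_eval_filter
    using filters_on_eventually_carrier[OF G] filters_on_eventually_carrier[OF F] by blast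
  moreover have "eval_filter G F \<noteq> bot"
    using G F by (simp add: eval_filter_def filtermap_bot_iff prod_filter_eq_bot filters_on_def)
  ultimately show ?thesis
    by (simp add: filters_on_def le_principal)
qed

lemma eval_filter_mono_left: "G \<le> G' \<Longrightarrow> eval_filter G F \<le> eval_filter G' F"
  unfolding eval_filter_def by (intro filtermap_mono prod_filter_mono order_refl)

text \<open>
  Zorn's lemma for the reversed order: a chain of proper filters has a proper infimum, because every
  set of the infimum already belongs to some filter of the chain.
\<close>

lemma ultrafilter_below:
  assumes F: "F \<in> filters_on X"
  obtains U where "U \<in> ultrafilters_on X" "U \<le> F"
proof -
  define S where "S = {G \<in> filters_on X. G \<le> F}"
  have "\<exists>U\<in>S. \<forall>G\<in>S. U \<ge> G \<longrightarrow> G = U"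
  proof (rule predicate_Zorn)
    show "partial_order_on S (relation_of (\<ge>) S)"
      by (rule partial_order_on_relation_ofI) auto
  next
    fix C assume C: "C \<in> Chains (relation_of (\<ge>) S)"
    show "\<exists>u\<in>S. \<forall>G\<in>C. G \<ge> u"
    proof (cases "C = {}")
      case True
      then show ?thesis using F by (auto simp: S_def)
    next
      case False
      have tot: "G \<le> H \<or> H \<le> G" if "G \<in> C" "H \<in> C" for G H
        using C that by (auto simp: Chains_def relation_of_def)
      have CS: "C \<subseteq> S"
        using C by (auto simp: Chains_def relation_of_def)
      obtain G0 where G0: "G0 \<in> C" using False by blast
      have "\<not> eventually (\<lambda>_. False) (Inf C)"
      proof (subst eventually_Inf_base)
        show "C \<noteq> {}" by fact
        show "\<exists>L\<in>C. L \<le> inf G H" if "G \<in> C" "H \<in> C" for G H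
          using tot[OF that] that by (auto simp: inf.absorb1 inf.absorb2)
        show "\<not> (\<exists>G\<in>C. eventually (\<lambda>_. False) G)"
          using CS by (auto simp: S_def filters_on_def eventually_False)
      qed
      then have "Inf C \<noteq> bot" by (simp add: eventually_False)
      moreover have "Inf C \<le> G0" using G0 by (rule Inf_lower)
      moreover have "G0 \<in> S" using CS G0 by blast
      ultimately have "Inf C \<in> S"
        unfolding S_def using filters_on_anti_mono by auto
      then show ?thesis by (auto intro: Inf_lower)
    qed
  qed
  then obtain U where U: "U \<in> S" "\<And>G. G \<in> S \<Longrightarrow> G \<le> U \<Longrightarrow> G = U" by blast
  show ?thesis
  proof (rule that)
    show "U \<in> ultrafilters_on X"
      using U by (auto simp: ultrafilters_on_def S_def)
    show "U \<le> F" using U by (simp add: S_def)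
  qed
qed

section \<open>Adherence in a convergence-approach space\<close>

context convergence_approach_space
begin

text \<open>The sup axiom makes finer filters converge better: if \<open>F \<le> G\<close> then \<open>sup F G = G\<close>.\<close>

lemma lam_mono:
  assumes "F \<le> G" "F \<noteq> bot" "G \<in> filters_on X" "x \<in> X"
  shows "lam F x \<le> lam G x"
proof -
  have "lam G x = sup (lam F x) (lam G x)"
    using lam_sup[of F G x] filters_on_anti_mono[OF assms(3,1,2)] assms
    by (simp add: sup.absorb2)
  then show ?thesis by (metis sup.cobounded1)
qed

lemma mem_adherenceI:
  assumes F: "F \<in> filters_on X" and A: "eventually (\<lambda>z. z \<in> A) F"
    and x: "x \<in> X" and le: "lam F x \<le> \<epsilon>"
  shows "x \<in> adherence X lam \<epsilon> A"
proof -
  obtain U where U: "U \<in> ultrafilters_on X" "U \<le> F"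
    using ultrafilter_below[OF F] .
  then have "U \<noteq> bot" by (auto simp: ultrafilters_on_def filters_on_def)
  then have "lam U x \<le> \<epsilon>"
    using lam_mono[OF U(2) _ F x] le by auto
  with U A x show ?thesis
    by (auto simp: adherence_def le_filter_def)
qed

lemma subset_adherence: "A \<subseteq> X \<Longrightarrow> A \<subseteq> adherence X lam \<epsilon> A"
  using mem_adherenceI[OF principal_in_filters_on]
  by (auto simp: eventually_principal lam_point)

lemma adherence_filter_in_filters_on:
  assumes F: "F \<in> filters_on X"
  shows "adherence_filter X lam \<epsilon> F \<in> filters_on X"
proof -
  have FX: "F \<le> principal X" and nb: "F \<noteq> bot"
    using F by (auto simp: filters_on_def)
  have "eventually (\<lambda>x. x \<in> X) (adherence_filter X lam \<epsilon> F)"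
    using filters_on_eventually_carrier[OF F]
    by (auto simp: eventually_adherence_filter[OF FX] adherence_def intro!: exI[of _ X])
  moreover have "\<not> eventually (\<lambda>_. False) (adherence_filter X lam \<epsilon> F)"
  proof
    assume "eventually (\<lambda>_. False) (adherence_filter X lam \<epsilon> F)"
    then obtain A where "A \<subseteq> X" "eventually (\<lambda>z. z \<in> A) F" "adherence X lam \<epsilon> A = {}"
      by (auto simp: eventually_adherence_filter[OF FX])
    then have "eventually (\<lambda>_. False) F"
      using subset_adherence[of A \<epsilon>] by simp
    then show False using nb by (simp add: eventually_False)
  qed
  ultimately show ?thesis
    by (simp add: filters_on_def le_principal eventually_False)
qed

text \<open>
  Pointwise control of the function filter becomes control of whole image filters: each value
  \<open>f x\<close> is adherent to all sets of values of the functions of \<open>F\<close> around \<open>x\<close>.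
\<close>

lemma filtermap_le_adherence_eval_filter:
  assumes G: "G \<in> filters_on Z" and F: "F \<in> filters_on (Z \<rightarrow>\<^sub>E X)" and f: "f \<in> Z \<rightarrow>\<^sub>E X"
    and pt: "\<And>x. x \<in> Z \<Longrightarrow> lam (eval_filter (principal {x}) F) (f x) \<le> \<alpha>"
  shows "filtermap f G \<le> adherence_filter X lam \<alpha> (eval_filter G F)"
proof (rule filter_leI)
  fix P assume "eventually P (adherence_filter X lam \<alpha> (eval_filter G F))"
  moreover have "eval_filter G F \<le> principal X"
    using eval_filter_in_filters_on[OF G F] by (simp add: filters_on_def)
  ultimately obtain C where C: "eventually (\<lambda>z. z \<in> C) (eval_filter G F)"
    and P: "\<And>y. y \<in> adherence X lam \<alpha> C \<Longrightarrow> P y"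
    by (auto simp: eventually_adherence_filter)
  obtain A B where A: "eventually (\<lambda>x. x \<in> A) G" and B: "eventually (\<lambda>h. h \<in> B) F"
    and AB: "\<And>x h. x \<in> A \<Longrightarrow> h \<in> B \<Longrightarrow> h x \<in> C"
    using C unfolding eventually_eval_filter by blast
  have "P (f x)" if "x \<in> A" "x \<in> Z" for x
  proof (intro P mem_adherenceI)
    show "eval_filter (principal {x}) F \<in> filters_on X"
      using eval_filter_in_filters_on[OF principal_in_filters_on[OF that(2)] F] .
    show "eventually (\<lambda>z. z \<in> C) (eval_filter (principal {x}) F)"
      unfolding eventually_eval_filter
      using B AB that by (intro exI[of _ "{x}"] exI[of _ B]) (auto simp: eventually_principal)
    show "f x \<in> X" using f that by auto
    show "lam (eval_filter (principal {x}) F) (f x) \<le> \<alpha>" using pt that by blast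
  qed
  then show "eventually P (filtermap f G)"
    unfolding eventually_filtermap
    using eventually_conj[OF A filters_on_eventually_carrier[OF G]]
    by (auto elim: eventually_mono)
qed

end

section \<open>Regular codomains\<close>

text \<open>The quotient form lets the bound pass to the infimum over all \<open>F\<close>.\<close>

lemma half_m_plus_le_hom_lam:
  assumes Y: "convergence_approach_space Y lamY" and reg: "regular_approach Y lamY"
    and X: "convergence_approach_space X lamX"
    and f: "f \<in> X \<rightarrow>\<^sub>E Y" and F: "F \<in> filters_on (X \<rightarrow>\<^sub>E Y)"
  shows "m_plus X lamX lamY f / 2 \<le> hom_lam X lamX lamY F f"
proof -
  interpret Y: convergence_approach_space Y lamY by fact
  interpret X: convergence_approach_space X lamX by fact
  have "m_plus X lamX lamY f \<le> 2 * \<alpha>"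
    if \<alpha>: "\<And>G x. G \<in> filters_on X \<Longrightarrow> x \<in> X \<Longrightarrow>
        lamY (eval_filter G F) (f x) \<le> sup (lamX G x) \<alpha>" for \<alpha>
    unfolding m_plus_def
  proof (intro Inf_lower CollectI ballI)
    fix G x assume G: "G \<in> filters_on X" and x: "x \<in> X"
    have fx: "f x \<in> Y" using f x by auto
    have EY: "eval_filter G F \<in> filters_on Y"
      using eval_filter_in_filters_on[OF G F] .
    have pt: "lamY (eval_filter (principal {z}) F) (f z) \<le> \<alpha>" if "z \<in> X" for z
      using \<alpha>[OF principal_in_filters_on[OF that] that] X.lam_point[OF that]
      by (simp add: sup.absorb2)
    have "lamY (filtermap f G) (f x) \<le> lamY (adherence_filter Y lamY \<alpha> (eval_filter G F)) (f x)"
      using Y.filtermap_le_adherence_eval_filter[OF G F f pt]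
        Y.adherence_filter_in_filters_on[OF EY] fx G
      by (intro Y.lam_mono) (auto simp: filtermap_bot_iff filters_on_def)
    also have "\<dots> \<le> lamY (eval_filter G F) (f x) + \<alpha>"
      using reg EY fx by (auto simp: regular_approach_def)
    also have "\<dots> \<le> sup (lamX G x) \<alpha> + \<alpha>"
      using \<alpha>[OF G x] by (rule add_right_mono)
    also have "\<dots> \<le> (lamX G x + \<alpha>) + \<alpha>"
      by (intro add_right_mono sup_least) simp_all
    also have "\<dots> = lamX G x + 2 * \<alpha>"
      by (simp add: mult_2 add.assoc)
    finally show "lamY (filtermap f G) (f x) \<le> lamX G x + 2 * \<alpha>" .
  qed
  then show ?thesis
    unfolding hom_lam_def by (intro Inf_greatest) (auto simp: divide_le_posI_ennreal)
qed

section \<open>The box filter\<close>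

text \<open>
  The filter of the box topology rather than of the product topology: infinitely many coordinates
  may be restricted at once. This makes the values near a non-isolated point uniformly small.
\<close>

definition box_filter :: "'a set \<Rightarrow> 'b set \<Rightarrow> ('a \<Rightarrow> 'b filter) \<Rightarrow> ('a \<Rightarrow> 'b) filter"
  where "box_filter X Y U =
    (INF S \<in> {S. \<forall>p\<in>X. eventually (\<lambda>y. y \<in> S p) (U p)}. principal (PiE X (\<lambda>p. S p \<inter> Y)))"

lemma eventually_box_filter:
  "eventually P (box_filter X Y U) \<longleftrightarrow>
    (\<exists>S. (\<forall>p\<in>X. eventually (\<lambda>y. y \<in> S p) (U p)) \<and> (\<forall>h \<in> PiE X (\<lambda>p. S p \<inter> Y). P h))"
proof -
  let ?B = "{S. \<forall>p\<in>X. eventually (\<lambda>y. y \<in> S p) (U p)}"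
  have ne: "?B \<noteq> {}" by (auto intro!: exI[of _ "\<lambda>_. UNIV"])
  have dir: "\<exists>R\<in>?B. principal (PiE X (\<lambda>p. R p \<inter> Y))
      \<le> inf (principal (PiE X (\<lambda>p. S p \<inter> Y))) (principal (PiE X (\<lambda>p. T p \<inter> Y)))"
    if "S \<in> ?B" "T \<in> ?B" for S T
    using that by (intro bexI[of _ "\<lambda>p. S p \<inter> T p"]) (auto simp: PiE_iff intro: eventually_conj)
  show ?thesis
    unfolding box_filter_def
    by (subst eventually_INF_base[OF ne dir]) (auto simp: eventually_principal)
qed

lemma box_filter_in_filters_on:
  assumes U: "\<And>p. p \<in> X \<Longrightarrow> U p \<in> filters_on Y"
  shows "box_filter X Y U \<in> filters_on (X \<rightarrow>\<^sub>E Y)"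
proof -
  have "eventually (\<lambda>h. h \<in> X \<rightarrow>\<^sub>E Y) (box_filter X Y U)"
    unfolding eventually_box_filter by (intro exI[of _ "\<lambda>_. UNIV"]) auto
  moreover have "\<not> eventually (\<lambda>_. False) (box_filter X Y U)"
  proof
    assume "eventually (\<lambda>_. False) (box_filter X Y U)"
    then obtain S where S: "\<And>p. p \<in> X \<Longrightarrow> eventually (\<lambda>y. y \<in> S p) (U p)"
      and "PiE X (\<lambda>p. S p \<inter> Y) = {}"
      unfolding eventually_box_filter by blast
    then obtain p where p: "p \<in> X" "S p \<inter> Y = {}" by (auto simp: PiE_eq_empty_iff)
    have "eventually (\<lambda>y. y \<in> S p \<inter> Y) (U p)"
      using eventually_conj[OF S[OF p(1)] filters_on_eventually_carrier[OF U[OF p(1)]]] by simp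
    then show False
      using U[OF p(1)] p(2) by (simp add: filters_on_def eventually_False)
  qed
  ultimately show ?thesis
    by (simp add: filters_on_def le_principal eventually_False)
qed

lemma eventually_box_filter_coordinates:
  assumes "\<And>p. p \<in> X \<Longrightarrow> eventually (\<lambda>y. y \<in> S p) (U p)"
  shows "eventually (\<lambda>h. h \<in> {h. \<forall>p\<in>X. h p \<in> S p}) (box_filter X Y U)"
  unfolding eventually_box_filter using assms by (intro exI[of _ S]) auto

lemma eval_filter_principal_box_filter_le:
  assumes p: "p \<in> X"
  shows "eval_filter (principal {p}) (box_filter X Y U) \<le> U p"
proof (rule filter_leI)
  fix P assume "eventually P (U p)"
  then have "eventually (\<lambda>h. h \<in> {h. \<forall>q\<in>X. h q \<in> (if q = p then {y. P y} else UNIV)})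
      (box_filter X Y U)" (is "eventually (\<lambda>h. h \<in> ?B) _")
    by (intro eventually_box_filter_coordinates) auto
  moreover have "\<forall>x\<in>{p}. \<forall>h\<in>?B. P (h x)" using p by auto
  moreover have "eventually (\<lambda>x. x \<in> {p}) (principal {p})"
    by (simp add: eventually_principal)
  ultimately show "eventually P (eval_filter (principal {p}) (box_filter X Y U))"
    unfolding eventually_eval_filter by blast
qed

section \<open>A topological space that unfolds an adherence filter\<close>

text \<open>
  Points \<open>y\<close> carry the label \<open>A\<close> because the ultrafilter that witnesses the adherence of \<open>y\<close> depends
  on \<open>A\<close>. In the topology below, the points \<open>Some (y, A)\<close> are isolated, and the labels shrink along
  \<open>F\<close> towards \<open>None\<close>.
\<close>

definition adherence_space ::
  "'b set \<Rightarrow> ('b filter \<Rightarrow> 'b \<Rightarrow> ennreal) \<Rightarrow> ennreal \<Rightarrow> 'b filter \<Rightarrow> ('b \<times> 'b set) option set"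
  where "adherence_space Y lam \<epsilon> F = insert None
    (Some ` {(y, A). A \<subseteq> Y \<and> eventually (\<lambda>z. z \<in> A) F \<and> y \<in> adherence Y lam \<epsilon> A})"

definition adherence_topology ::
  "'b set \<Rightarrow> ('b filter \<Rightarrow> 'b \<Rightarrow> ennreal) \<Rightarrow> ennreal \<Rightarrow> 'b filter \<Rightarrow> ('b \<times> 'b set) option topology"
  where "adherence_topology Y lam \<epsilon> F = topology (\<lambda>W. W \<subseteq> adherence_space Y lam \<epsilon> F \<and>
    (None \<in> W \<longrightarrow> (\<exists>A0 \<subseteq> Y. eventually (\<lambda>z. z \<in> A0) F \<and>
      (\<forall>y A. A \<subseteq> A0 \<longrightarrow> Some (y, A) \<in> adherence_space Y lam \<epsilon> F \<longrightarrow> Some (y, A) \<in> W))))"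

lemma openin_adherence_topology:
  "openin (adherence_topology Y lam \<epsilon> F) W \<longleftrightarrow> W \<subseteq> adherence_space Y lam \<epsilon> F \<and>
    (None \<in> W \<longrightarrow> (\<exists>A0 \<subseteq> Y. eventually (\<lambda>z. z \<in> A0) F \<and>
      (\<forall>y A. A \<subseteq> A0 \<longrightarrow> Some (y, A) \<in> adherence_space Y lam \<epsilon> F \<longrightarrow> Some (y, A) \<in> W)))"
proof -
  define N where "N W A0 \<longleftrightarrow> A0 \<subseteq> Y \<and> eventually (\<lambda>z. z \<in> A0) F \<and>
      (\<forall>y A. A \<subseteq> A0 \<longrightarrow> Some (y, A) \<in> adherence_space Y lam \<epsilon> F \<longrightarrow> Some (y, A) \<in> W)" for W A0
  have N_Int: "N (V \<inter> W) (A \<inter> B)" if "N V A" "N W B" for V W A B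
    using that by (auto simp: N_def intro: eventually_conj)
  have N_mono: "N V A" if "N W A" "W \<subseteq> V" for V W A
    using that by (auto simp: N_def)
  have "istopology (\<lambda>W. W \<subseteq> adherence_space Y lam \<epsilon> F \<and> (None \<in> W \<longrightarrow> (\<exists>A0. N W A0)))"
    unfolding istopology_def
  proof (rule conjI; intro allI impI)
    fix V W
    assume V: "V \<subseteq> adherence_space Y lam \<epsilon> F \<and> (None \<in> V \<longrightarrow> (\<exists>A0. N V A0))"
      and W: "W \<subseteq> adherence_space Y lam \<epsilon> F \<and> (None \<in> W \<longrightarrow> (\<exists>A0. N W A0))"
    then show "V \<inter> W \<subseteq> adherence_space Y lam \<epsilon> F \<and> (None \<in> V \<inter> W \<longrightarrow> (\<exists>A0. N (V \<inter> W) A0))"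
      using N_Int by (metis IntD1 IntD2 le_infI1)
  next
    fix K
    assume K: "\<forall>W\<in>K. W \<subseteq> adherence_space Y lam \<epsilon> F \<and> (None \<in> W \<longrightarrow> (\<exists>A0. N W A0))"
    have "\<exists>A0. N (\<Union> K) A0" if "None \<in> \<Union> K"
    proof -
      obtain W where "W \<in> K" "None \<in> W" using \<open>None \<in> \<Union> K\<close> by (rule UnionE)
      moreover from this obtain A0 where "N W A0" using K by auto
      ultimately show ?thesis using N_mono[of W A0 "\<Union> K"] by auto
    qed
    moreover have "\<Union> K \<subseteq> adherence_space Y lam \<epsilon> F" using K by (simp add: Sup_le_iff)
    ultimately show "\<Union> K \<subseteq> adherence_space Y lam \<epsilon> F \<and> (None \<in> \<Union> K \<longrightarrow> (\<exists>A0. N (\<Union> K) A0))"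
      by simp
  qed
  then show ?thesis
    unfolding adherence_topology_def N_def by (simp only: topology_inverse')
qed

lemma topspace_adherence_topology [simp]:
  assumes "F \<in> filters_on Y"
  shows "topspace (adherence_topology Y lam \<epsilon> F) = adherence_space Y lam \<epsilon> F"
proof -
  have "openin (adherence_topology Y lam \<epsilon> F) (adherence_space Y lam \<epsilon> F)"
    using filters_on_eventually_carrier[OF assms]
    unfolding openin_adherence_topology by (intro conjI impI exI[of _ Y]) simp_all
  then have "adherence_space Y lam \<epsilon> F \<subseteq> topspace (adherence_topology Y lam \<epsilon> F)"
    by (rule openin_subset)
  moreover have "topspace (adherence_topology Y lam \<epsilon> F) \<subseteq> adherence_space Y lam \<epsilon> F"
    using iffD1[OF openin_adherence_topology openin_topspace] by (rule conjunct1)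
  ultimately show ?thesis by (intro subset_antisym)
qed

lemma nhdsin_adherence_topology_Some:
  assumes F: "F \<in> filters_on Y" and p: "Some q \<in> adherence_space Y lam \<epsilon> F"
  shows "nhdsin (adherence_topology Y lam \<epsilon> F) (Some q) = principal {Some q}"
proof -
  have "openin (adherence_topology Y lam \<epsilon> F) {Some q}"
    using p unfolding openin_adherence_topology by simp
  then show ?thesis
    using p F by (auto simp: filter_eq_iff eventually_nhdsin eventually_principal)
qed

lemma eventually_nhdsin_adherence_topology_None:
  assumes F: "F \<in> filters_on Y"
  shows "eventually P (nhdsin (adherence_topology Y lam \<epsilon> F) None) \<longleftrightarrow>
    P None \<and> (\<exists>A0 \<subseteq> Y. eventually (\<lambda>z. z \<in> A0) F \<and>
      (\<forall>y A. A \<subseteq> A0 \<longrightarrow> Some (y, A) \<in> adherence_space Y lam \<epsilon> F \<longrightarrow> P (Some (y, A))))"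
    (is "?L \<longleftrightarrow> ?R")
proof
  have None: "None \<in> topspace (adherence_topology Y lam \<epsilon> F)"
    using F by (simp add: adherence_space_def)
  show ?R if L: ?L
  proof -
    obtain W where W: "openin (adherence_topology Y lam \<epsilon> F) W" "None \<in> W" "\<And>p. p \<in> W \<Longrightarrow> P p"
      using L None by (auto simp: eventually_nhdsin)
    then obtain A0 where "A0 \<subseteq> Y" "eventually (\<lambda>z. z \<in> A0) F"
        "\<And>y A. A \<subseteq> A0 \<Longrightarrow> Some (y, A) \<in> adherence_space Y lam \<epsilon> F \<Longrightarrow> Some (y, A) \<in> W"
      by (auto simp: openin_adherence_topology)
    then show ?thesis using W by (intro conjI exI[of _ A0]) auto
  qed
  assume ?R
  let ?W = "{p \<in> adherence_space Y lam \<epsilon> F. P p}"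
  have "openin (adherence_topology Y lam \<epsilon> F) ?W"
    unfolding openin_adherence_topology using \<open>?R\<close> by (elim conjE exE) (intro conjI impI exI, auto)
  moreover have "None \<in> ?W" using \<open>?R\<close> by (simp add: adherence_space_def)
  ultimately show ?L
    unfolding eventually_nhdsin using None by (intro disjI2 conjI exI[of _ ?W]) auto
qed

definition unfolded_adherence ::
  "'b set \<Rightarrow> ('b filter \<Rightarrow> 'b \<Rightarrow> ennreal) \<Rightarrow> ennreal \<Rightarrow> 'b filter \<Rightarrow> 'b \<Rightarrow> ('b \<times> 'b set) option \<Rightarrow> 'b"
  where "unfolded_adherence Y lam \<epsilon> F y0 =
    restrict (case_option y0 fst) (adherence_space Y lam \<epsilon> F)"

lemma unfolded_adherence_in_PiE:
  "y0 \<in> Y \<Longrightarrow> unfolded_adherence Y lam \<epsilon> F y0 \<in> adherence_space Y lam \<epsilon> F \<rightarrow>\<^sub>E Y"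
  by (auto simp: unfolded_adherence_def adherence_space_def adherence_def)

section \<open>Codomains that are not regular\<close>

context convergence_approach_space
begin

text \<open>
  The neighborhood filter of \<open>None\<close> has limit value \<open>0\<close> there, and its image is coarser than the
  adherence filter.
\<close>

lemma lam_adherence_filter_le_m_plus:
  fixes F :: "'a filter" and \<epsilon> :: ennreal
  assumes F: "F \<in> filters_on X" and y0: "y0 \<in> X"
  defines "T \<equiv> adherence_topology X lam \<epsilon> F"
  shows "lam (adherence_filter X lam \<epsilon> F) y0
    \<le> m_plus (topspace T) (topological_lam T) lam (unfolded_adherence X lam \<epsilon> F y0)"
  unfolding m_plus_def
proof (rule Inf_greatest, elim CollectE)
  let ?f = "unfolded_adherence X lam \<epsilon> F y0"
  fix \<alpha> assume \<alpha>: "\<forall>G\<in>filters_on (topspace T). \<forall>x\<in>topspace T.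
      lam (filtermap ?f G) (?f x) \<le> topological_lam T G x + \<alpha>"
  have top: "topspace T = adherence_space X lam \<epsilon> F"
    unfolding T_def using F by simp
  have FX: "F \<le> principal X" using F by (simp add: filters_on_def)
  have None: "None \<in> topspace T" by (simp add: top adherence_space_def)
  have N: "nhdsin T None \<in> filters_on (topspace T)"
    using None
    by (auto simp: filters_on_def le_principal eventually_nhdsin trivial_limit_def
        intro: openin_topspace)
  have f: "?f \<in> topspace T \<rightarrow>\<^sub>E X"
    unfolding top using y0 by (rule unfolded_adherence_in_PiE)
  have f_None: "?f None = y0"
    by (simp add: unfolded_adherence_def adherence_space_def)
  have "adherence_filter X lam \<epsilon> F \<le> filtermap ?f (nhdsin T None)"
  proof (rule filter_leI)
    fix P assume "eventually P (filtermap ?f (nhdsin T None))"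
    then obtain A0 where A0: "A0 \<subseteq> X" "eventually (\<lambda>z. z \<in> A0) F"
      and P: "\<And>y A. A \<subseteq> A0 \<Longrightarrow> Some (y, A) \<in> adherence_space X lam \<epsilon> F \<Longrightarrow> P (?f (Some (y, A)))"
      unfolding T_def eventually_filtermap eventually_nhdsin_adherence_topology_None[OF F] by blast
    have "P y" if "y \<in> adherence X lam \<epsilon> A0" for y
    proof -
      have "Some (y, A0) \<in> adherence_space X lam \<epsilon> F"
        using A0 that by (auto simp: adherence_space_def)
      then show ?thesis using P[of A0 y] by (simp add: unfolded_adherence_def)
    qed
    then show "eventually P (adherence_filter X lam \<epsilon> F)"
      using A0 by (auto simp: eventually_adherence_filter[OF FX])
  qed
  moreover have "filtermap ?f (nhdsin T None) \<in> filters_on X"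
    using N f by (intro filtermap_in_filters_on[where X = "topspace T"]) auto
  moreover have "adherence_filter X lam \<epsilon> F \<noteq> bot"
    using adherence_filter_in_filters_on[OF F, of \<epsilon>] by (simp add: filters_on_def)
  ultimately have "lam (adherence_filter X lam \<epsilon> F) y0 \<le> lam (filtermap ?f (nhdsin T None)) y0"
    using y0 by (intro lam_mono)
  also have "\<dots> \<le> topological_lam T (nhdsin T None) None + \<alpha>"
    using bspec[OF bspec[OF \<alpha> N] None] by (simp add: f_None)
  also have "\<dots> = \<alpha>" by (simp add: topological_lam_def)
  finally show "lam (adherence_filter X lam \<epsilon> F) y0 \<le> \<alpha>" .
qed

text \<open>
  The values of the function filter at \<open>Some (y, A)\<close> are drawn from an ultrafilter that witnesses the
  adherence of \<open>y\<close> to \<open>A\<close>, hence lie in \<open>A\<close>. Near \<open>None\<close> the sets \<open>A\<close> shrink along \<open>F\<close>, so there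
  the evaluation filter is finer than \<open>sup F (principal {y0})\<close>.
\<close>

lemma exists_function_filter_hom_lam_le:
  fixes F :: "'a filter" and \<epsilon> :: ennreal
  assumes F: "F \<in> filters_on X" and y0: "y0 \<in> X"
  defines "T \<equiv> adherence_topology X lam \<epsilon> F"
  obtains H where "H \<in> filters_on (topspace T \<rightarrow>\<^sub>E X)"
    "hom_lam (topspace T) (topological_lam T) lam H (unfolded_adherence X lam \<epsilon> F y0)
      \<le> sup (lam F y0) \<epsilon>"
proof -
  let ?f = "unfolded_adherence X lam \<epsilon> F y0"
  have top: "topspace T = adherence_space X lam \<epsilon> F"
    unfolding T_def using F by simp
  have "\<forall>y A. \<exists>V. y \<in> adherence X lam \<epsilon> A \<longrightarrow>
      V \<in> filters_on X \<and> eventually (\<lambda>z. z \<in> A) V \<and> lam V y \<le> \<epsilon>"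
    by (auto simp: adherence_def ultrafilters_on_def)
  then obtain V where V: "\<And>y A. y \<in> adherence X lam \<epsilon> A \<Longrightarrow>
      V y A \<in> filters_on X \<and> eventually (\<lambda>z. z \<in> A) (V y A) \<and> lam (V y A) y \<le> \<epsilon>"
    by metis
  define U where "U = case_option (principal {y0}) (\<lambda>(y, A). V y A)"
  define H where "H = box_filter (topspace T) X U"
  have U: "U p \<in> filters_on X" if "p \<in> topspace T" for p
    using that V y0 by (auto simp: U_def top adherence_space_def principal_in_filters_on)
  have H: "H \<in> filters_on (topspace T \<rightarrow>\<^sub>E X)"
    unfolding H_def using U by (rule box_filter_in_filters_on)
  have near_None: "eval_filter (nhdsin T None) H \<le> sup F (principal {y0})"
  proof (rule filter_leI)
    fix P assume "eventually P (sup F (principal {y0}))"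
    then have P: "eventually P F" "P y0" by (auto simp: eventually_sup eventually_principal)
    define S where "S = case_option {y0} (\<lambda>(y :: 'a, A :: 'a set). A)"
    define A0 where "A0 = {z \<in> X. P z}"
    define D where "D = {p \<in> topspace T. S p \<subseteq> {z. P z}}"
    have A0: "A0 \<subseteq> X" "eventually (\<lambda>z. z \<in> A0) F"
      using eventually_conj[OF P(1) filters_on_eventually_carrier[OF F]]
      by (auto simp: A0_def conj_commute)
    have "eventually (\<lambda>h. h \<in> {h. \<forall>p\<in>topspace T. h p \<in> S p}) H"
      unfolding H_def
    proof (rule eventually_box_filter_coordinates)
      show "eventually (\<lambda>y. y \<in> S p) (U p)" if "p \<in> topspace T" for p
        using that V by (auto simp: U_def S_def top adherence_space_def eventually_principal)
    qed
    moreover have "eventually (\<lambda>p. p \<in> D) (nhdsin T None)"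
      unfolding T_def eventually_nhdsin_adherence_topology_None[OF F]
    proof (intro conjI exI[of _ A0] allI impI)
      show "None \<in> D" using P by (simp add: D_def S_def top adherence_space_def)
      show "Some (y, A) \<in> D" if "A \<subseteq> A0" "Some (y, A) \<in> adherence_space X lam \<epsilon> F" for y A
        using that by (auto simp: D_def S_def top A0_def)
    qed (use A0 in auto)
    moreover have "P (h p)" if "p \<in> D" "h \<in> {h. \<forall>p\<in>topspace T. h p \<in> S p}" for p h
      using that by (auto simp: D_def)
    ultimately show "eventually P (eval_filter (nhdsin T None) H)"
      unfolding eventually_eval_filter by blast
  qed
  have "hom_lam (topspace T) (topological_lam T) lam H ?f \<le> sup (lam F y0) \<epsilon>"
    unfolding hom_lam_def
  proof (intro Inf_lower CollectI ballI)
    fix G p assume G: "G \<in> filters_on (topspace T)" and p: "p \<in> topspace T"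
    have E: "eval_filter G H \<noteq> bot"
      using eval_filter_in_filters_on[OF G H] by (simp add: filters_on_def)
    show "lam (eval_filter G H) (?f p) \<le> sup (topological_lam T G p) (sup (lam F y0) \<epsilon>)"
    proof (cases "G \<le> nhdsin T p")
      case False
      then show ?thesis by (simp add: topological_lam_def sup.absorb1)
    next
      case True
      then have le: "eval_filter G H \<le> eval_filter (nhdsin T p) H"
        by (rule eval_filter_mono_left)
      have "lam (eval_filter G H) (?f p) \<le> sup (lam F y0) \<epsilon>"
      proof (cases p)
        case None
        have y0F: "principal {y0} \<in> filters_on X" using y0 by (rule principal_in_filters_on)
        have "sup F (principal {y0}) \<in> filters_on X"
          using F y0F by (auto simp: filters_on_def)
        then have "lam (eval_filter G H) y0 \<le> lam (sup F (principal {y0})) y0"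
          using lam_mono[OF _ E _ y0] le near_None None by (meson order_trans)
        also have "\<dots> = sup (lam F y0) 0"
          using lam_sup[OF F y0F y0] lam_point[OF y0] by simp
        also have "\<dots> \<le> sup (lam F y0) \<epsilon>" by (simp add: sup.coboundedI2 sup_mono)
        finally show ?thesis
          using None by (simp add: unfolded_adherence_def adherence_space_def)
      next
        case (Some q)
        obtain y A where q: "q = (y, A)" by force
        have y: "y \<in> adherence X lam \<epsilon> A" "y \<in> X"
          using p Some q by (auto simp: top adherence_space_def adherence_def)
        have "nhdsin T p = principal {p}"
          unfolding T_def Some
          using nhdsin_adherence_topology_Some[OF F] p Some top by metis
        then have "eval_filter G H \<le> V y A"
          using le eval_filter_principal_box_filter_le[OF p, of X U] Some q
          by (simp add: H_def U_def)
        then have "lam (eval_filter G H) y \<le> \<epsilon>"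
          using lam_mono[OF _ E _ y(2)] V[OF y(1)] order_trans by blast
        moreover have "?f p = y"
          using p Some q by (simp add: unfolded_adherence_def top)
        ultimately show ?thesis by (simp add: le_supI2)
      qed
      then show ?thesis by (simp add: le_supI2)
    qed
  qed
  with H show ?thesis by (rule that)
qed

end

theorem corollary4:
  fixes Y :: "'b set" and lamY :: "'b filter \<Rightarrow> 'b \<Rightarrow> ennreal"
  assumes "convergence_approach_space Y lamY"
  shows "(regular_approach Y lamY \<longrightarrow>
      (\<forall>(X :: 'a set) lamX. convergence_approach_space X lamX \<longrightarrow>
        (\<forall>f \<in> X \<rightarrow>\<^sub>E Y.
          m_plus X lamX lamY f \<le> 2 * (INF F \<in> filters_on (X \<rightarrow>\<^sub>E Y). hom_lam X lamX lamY F f))))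
    \<and> (\<not> regular_approach Y lamY \<longrightarrow>
      (\<exists>T :: ('b \<times> 'b set) option topology. \<exists>f \<in> topspace T \<rightarrow>\<^sub>E Y.
        (INF F \<in> filters_on (topspace T \<rightarrow>\<^sub>E Y).
          hom_lam (topspace T) (topological_lam T) lamY F f)
        < m_plus (topspace T) (topological_lam T) lamY f))"
proof (intro conjI impI allI ballI)
  fix X :: "'a set" and lamX f
  assume reg: "regular_approach Y lamY" and X: "convergence_approach_space X lamX"
    and f: "f \<in> X \<rightarrow>\<^sub>E Y"
  have "m_plus X lamX lamY f / 2 \<le> (INF F \<in> filters_on (X \<rightarrow>\<^sub>E Y). hom_lam X lamX lamY F f)"
    using half_m_plus_le_hom_lam[OF assms reg X f] by (intro INF_greatest)
  then have "2 * (m_plus X lamX lamY f / 2)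
      \<le> 2 * (INF F \<in> filters_on (X \<rightarrow>\<^sub>E Y). hom_lam X lamX lamY F f)"
    by (rule mult_left_mono) simp
  then show "m_plus X lamX lamY f \<le> 2 * (INF F \<in> filters_on (X \<rightarrow>\<^sub>E Y). hom_lam X lamX lamY F f)"
    by (simp add: ennreal_times_divide mult.commute[of 2] mult_divide_eq_ennreal)
next
  interpret convergence_approach_space Y lamY by fact
  assume "\<not> regular_approach Y lamY"
  then obtain F \<epsilon> y0 where F: "F \<in> filters_on Y" and y0: "y0 \<in> Y"
    and less: "lamY F y0 + \<epsilon> < lamY (adherence_filter Y lamY \<epsilon> F) y0"
    by (auto simp: regular_approach_def not_le)
  let ?T = "adherence_topology Y lamY \<epsilon> F" and ?f = "unfolded_adherence Y lamY \<epsilon> F y0"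
  obtain H where H: "H \<in> filters_on (topspace ?T \<rightarrow>\<^sub>E Y)"
    and le: "hom_lam (topspace ?T) (topological_lam ?T) lamY H ?f \<le> sup (lamY F y0) \<epsilon>"
    using exists_function_filter_hom_lam_le[OF F y0] .
  have "(INF H \<in> filters_on (topspace ?T \<rightarrow>\<^sub>E Y).
      hom_lam (topspace ?T) (topological_lam ?T) lamY H ?f) \<le> sup (lamY F y0) \<epsilon>"
    using H le by (rule INF_lower2)
  also have "\<dots> \<le> lamY F y0 + \<epsilon>" by (intro sup_least) simp_all
  also note less
  also have "lamY (adherence_filter Y lamY \<epsilon> F) y0
      \<le> m_plus (topspace ?T) (topological_lam ?T) lamY ?f"
    using F y0 by (rule lam_adherence_filter_le_m_plus)
  finally have "(INF H \<in> filters_on (topspace ?T \<rightarrow>\<^sub>E Y).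
      hom_lam (topspace ?T) (topological_lam ?T) lamY H ?f)
      < m_plus (topspace ?T) (topological_lam ?T) lamY ?f" .
  moreover have "?f \<in> topspace ?T \<rightarrow>\<^sub>E Y"
    using unfolded_adherence_in_PiE[OF y0] F by simp
  ultimately show "\<exists>T :: ('b \<times> 'b set) option topology. \<exists>f \<in> topspace T \<rightarrow>\<^sub>E Y.
        (INF F \<in> filters_on (topspace T \<rightarrow>\<^sub>E Y).
          hom_lam (topspace T) (topological_lam T) lamY F f)
        < m_plus (topspace T) (topological_lam T) lamY f"
    by blast
qed

end
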